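(* For any skew shape $\sigma$ with $k$ rows, $$\sum_{i=1}^k f^{{}^i\sigma}=\sum_{i=1}^k f^{\sigma^i}.$$
   Context: For partitions $\lambda=(\lambda_1\ge\cdots\ge\lambda_k>0)$ and $\mu$ with $\mu_i\le\lambda_i$ for all $i$ (missing parts are $0$), the skew shape $\sigma=\lambda\setminus\mu$ consists of the boxes $(i,j)$ (row $i$ from the top, column $j$ from the left) with $\mu_i<j\le\lambda_i$; it has $k$ rows. $f^\tau$ is the number of standard fillings of a skew shape $\tau$ with $m$ boxes: bijective fillings with $1,\ldots,m$ strictly increasing along rows and columns. $\sigma^i$ (resp. ${}^i\sigma$) denotes the shape obtained from $\sigma$ by adding a box to row $i$ on the right (resp. on the left) if the result is again a skew shape; otherwise, by convention, $f^{\sigma^i}=0$ (resp. $f^{{}^i\sigma}=0$). Explicitly $\sigma^i$ is a skew shape iff $i=1$ or $\lambda_i<\lambda_{i-1}$; ${}^i\sigma$ is a skew shape iff $i=k$ (translating the shape one column to the right if $\mu_k=0$) or $\mu_i>\mu_{i+1}$. *)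

theory Defs
  imports "HOL-Library.FuncSet"
begin

text \<open>
  A skew shape with \<open>k\<close> rows is a pair \<open>(lam, mu)\<close> of lists of length \<open>k\<close>: the parts of the outer
  partition, all positive, and those of the inner partition, padded with zeros to length \<open>k\<close>.
  The pair, and not just its set of boxes, is the shape: rows may be empty, and an empty row still
  has a position where a box can be added. Rows are counted from 0, following list indexing, and
  columns from 1.
\<close>

type_synonym skew = "nat list \<times> nat list"

fun skew_shape :: "skew \<Rightarrow> bool" where
  "skew_shape (lam, mu) \<longleftrightarrow>
     sorted_wrt (\<ge>) lam \<and> (\<forall>p \<in> set lam. 0 < p) \<and> sorted_wrt (\<ge>) mu \<and> list_all2 (\<le>) mu lam"

fun num_rows :: "skew \<Rightarrow> nat" where
  "num_rows (lam, mu) = length lam"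

fun boxes :: "skew \<Rightarrow> (nat \<times> nat) set" where
  "boxes (lam, mu) = {(i, j). i < length lam \<and> mu ! i < j \<and> j \<le> lam ! i}"

text \<open>Fillings are extensional functions, so that each is counted once.\<close>

definition standard_fillings :: "skew \<Rightarrow> (nat \<times> nat \<Rightarrow> nat) set" where
  "standard_fillings \<sigma> =
     {T \<in> extensional (boxes \<sigma>).
        bij_betw T (boxes \<sigma>) {1..card (boxes \<sigma>)} \<and>
        (\<forall>i j j'. (i, j) \<in> boxes \<sigma> \<and> (i, j') \<in> boxes \<sigma> \<and> j < j' \<longrightarrow> T (i, j) < T (i, j')) \<and>
        (\<forall>i i' j. (i, j) \<in> boxes \<sigma> \<and> (i', j) \<in> boxes \<sigma> \<and> i < i' \<longrightarrow> T (i, j) < T (i', j))}"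

definition num_standard :: "skew \<Rightarrow> nat" where
  "num_standard \<sigma> = card (standard_fillings \<sigma>)"

fun add_right :: "nat \<Rightarrow> skew \<Rightarrow> skew" where
  "add_right i (lam, mu) = (lam[i := lam ! i + 1], mu)"

fun shift_right :: "skew \<Rightarrow> skew" where
  "shift_right (lam, mu) = (map Suc lam, map Suc mu)"

text \<open>
  If row \<open>i\<close> already reaches column 1, the shape is first translated one column to the right. For a
  row \<open>i\<close> other than the last, the result is then never a skew shape.
\<close>

fun add_left :: "nat \<Rightarrow> skew \<Rightarrow> skew" where
  "add_left i (lam, mu) =
     (if mu ! i = 0 then (let (lam', mu') = shift_right (lam, mu) in (lam', mu'[i := 0]))
      else (lam, mu[i := mu ! i - 1]))"

definition num_standard_right :: "nat \<Rightarrow> skew \<Rightarrow> nat" where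
  "num_standard_right i \<sigma> =
     (if skew_shape (add_right i \<sigma>) then num_standard (add_right i \<sigma>) else 0)"

definition num_standard_left :: "nat \<Rightarrow> skew \<Rightarrow> nat" where
  "num_standard_left i \<sigma> =
     (if skew_shape (add_left i \<sigma>) then num_standard (add_left i \<sigma>) else 0)"

lemma skew_shape_iff_nth:
  "skew_shape (lam, mu) \<longleftrightarrow> length mu = length lam \<and>
     (\<forall>i. Suc i < length lam \<longrightarrow> lam ! Suc i \<le> lam ! i \<and> mu ! Suc i \<le> mu ! i) \<and>
     (\<forall>i < length lam. 0 < lam ! i \<and> mu ! i \<le> lam ! i)"
proof -
  have *: "sorted_wrt (\<ge>) xs \<longleftrightarrow> (\<forall>i. Suc i < length xs \<longrightarrow> xs ! Suc i \<le> xs ! i)" for xs :: "nat list"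
    by (rule sorted_wrt_iff_nth_Suc_transp) (auto simp: transp_def)
  show ?thesis
    unfolding skew_shape.simps * list_all2_conv_all_nth all_set_conv_all_nth by auto
qed

lemma skew_shape_add_right_iff:
  assumes "skew_shape (lam, mu)" "i < length lam"
  shows "skew_shape (add_right i (lam, mu)) \<longleftrightarrow> i = 0 \<or> lam ! i < lam ! (i - 1)"
  using assms unfolding add_right.simps skew_shape_iff_nth
  by (cases i) (auto simp: nth_list_update le_SucI split: if_splits)

lemma skew_shape_add_left_iff:
  assumes "skew_shape (lam, mu)" "i < length lam"
  shows "skew_shape (add_left i (lam, mu)) \<longleftrightarrow> Suc i = length lam \<or> mu ! i > mu ! Suc i"
proof -
  have 1: "length mu = length lam" and 2: "\<And>n. Suc n < length lam \<Longrightarrow> mu ! Suc n \<le> mu ! n"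
    and 3: "\<And>n. Suc n < length lam \<Longrightarrow> lam ! Suc n \<le> lam ! n"
    and 4: "\<And>n. n < length lam \<Longrightarrow> 0 < lam ! n \<and> mu ! n \<le> lam ! n"
    using assms(1) unfolding skew_shape_iff_nth by auto
  show ?thesis
  proof (cases "mu ! i = 0")
    case True
    then show ?thesis using 1 2 3 4 assms(2)
      by (auto simp: skew_shape_iff_nth nth_list_update simp del: skew_shape.simps split: if_splits)
  next
    case False
    have "mu ! Suc n \<le> mu[i := mu ! i - 1] ! n" if "n \<noteq> i" "Suc n < length lam" for n
      using that 2[of n] by simp
    moreover have "mu[i := mu ! i - 1] ! Suc n \<le> mu ! n" if "Suc n < length lam" for n
      using that assms(2) 1 2[of n] by (auto simp: nth_list_update)
    moreover have "mu[i := mu ! i - 1] ! n \<le> lam ! n" if "n < length lam" for n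
      using that assms(2) 1 4[of n] by (auto simp: nth_list_update)
    ultimately have "skew_shape (lam, mu[i := mu ! i - 1]) \<longleftrightarrow>
        (Suc i < length lam \<longrightarrow> mu ! Suc i \<le> mu ! i - 1)"
      unfolding skew_shape_iff_nth using 1 3 4 assms(2)
      by (simp add: nth_list_update)
    then show ?thesis using False assms(2) by auto
  qed
qed

lemma boxes_add_right:
  assumes "skew_shape (lam, mu)" "i < length lam"
  shows "boxes (add_right i (lam, mu)) = insert (i, lam ! i + 1) (boxes (lam, mu))"
  using assms by (auto simp: skew_shape_iff_nth nth_list_update simp del: skew_shape.simps split: if_splits)

lemma boxes_add_left:
  assumes "skew_shape (lam, mu)" "i < length lam"
  shows "boxes (add_left i (lam, mu)) =
    (if mu ! i = 0 then insert (i, 1) (boxes (shift_right (lam, mu)))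
     else insert (i, mu ! i) (boxes (lam, mu)))"
  using assms by (auto simp: skew_shape_iff_nth nth_list_update simp del: skew_shape.simps split: if_splits)

end

theory Submission
  imports Defs
begin

text \<open>
  A standard filling of \<open>\<lambda> \<setminus> \<mu>\<close> is a saturated chain from \<open>\<mu>\<close> to \<open>\<lambda>\<close> in the lattice of weakly
  decreasing vectors in \<open>\<int>\<^sup>k\<close>. On the free module over these vectors let \<open>U\<close> send a vector \<open>v\<close> to
  the sum of all weakly decreasing \<open>v + e\<^sub>i\<close>, and let \<open>D\<close> send \<open>v\<close> to the sum of all weakly
  decreasing \<open>v - e\<^sub>i\<close>. Then \<open>U\<close> and \<open>D\<close> commute: for \<open>i \<noteq> j\<close>, if \<open>v + e\<^sub>i - e\<^sub>j\<close> is weakly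
  decreasing then so are both \<open>v + e\<^sub>i\<close> and \<open>v - e\<^sub>j\<close>, and the coefficient of \<open>v\<close> in both \<open>U D v\<close>
  and \<open>D U v\<close> is the number of distinct entries of \<open>v\<close>. The two sides of the theorem are the
  coefficients of \<open>\<lambda>\<close> in \<open>U\<^sup>n D \<mu>\<close> and in \<open>D U\<^sup>n \<mu>\<close>, where \<open>n\<close> is one more than the number of
  boxes.
\<close>

section \<open>Linear extensions\<close>

text \<open>\<open>r\<close> is an arbitrary relation, not assumed transitive, so the row and column
  conditions of a filling can be used directly instead of their transitive closure.\<close>

definition linear_exts :: "('a \<Rightarrow> 'a \<Rightarrow> bool) \<Rightarrow> 'a set \<Rightarrow> ('a \<Rightarrow> nat) set" where
  "linear_exts r S =
     {T \<in> extensional S. bij_betw T S {1..card S} \<and> (\<forall>x\<in>S. \<forall>y\<in>S. r x y \<longrightarrow> T x < T y)}"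

lemma finite_linear_exts:
  assumes "finite S"
  shows "finite (linear_exts r S)"
proof (rule finite_subset)
  show "linear_exts r S \<subseteq> S \<rightarrow>\<^sub>E {1..card S}"
    by (auto simp: linear_exts_def PiE_def bij_betw_def)
  show "finite (S \<rightarrow>\<^sub>E {1..card S})"
    using assms by (intro finite_PiE) auto
qed

lemma linear_exts_empty: "linear_exts r {} = {\<lambda>_. undefined}"
  by (auto simp: linear_exts_def bij_betw_def)

lemma card_linear_exts_image:
  assumes inj: "inj_on f S" and r: "\<And>x y. x \<in> S \<Longrightarrow> y \<in> S \<Longrightarrow> s (f x) (f y) \<longleftrightarrow> r x y"
  shows "card (linear_exts s (f ` S)) = card (linear_exts r S)"
proof (rule bij_betw_same_card)
  let ?g = "inv_into S f"
  have card: "card (f ` S) = card S"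
    using inj by (rule card_image)
  have bij: "bij_betw f S (f ` S)"
    using inj by (simp add: bij_betw_def)
  show "bij_betw (\<lambda>T. restrict (T \<circ> f) S) (linear_exts s (f ` S)) (linear_exts r S)"
  proof (rule bij_betw_byWitness[where f' = "\<lambda>T. restrict (T \<circ> ?g) (f ` S)"])
    show "\<forall>T\<in>linear_exts s (f ` S). restrict (restrict (T \<circ> f) S \<circ> ?g) (f ` S) = T"
      using inj by (auto simp: linear_exts_def extensional_def fun_eq_iff restrict_def)
    show "\<forall>T\<in>linear_exts r S. restrict (restrict (T \<circ> ?g) (f ` S) \<circ> f) S = T"
      using inj by (auto simp: linear_exts_def extensional_def fun_eq_iff restrict_def)
    show "(\<lambda>T. restrict (T \<circ> f) S) ` linear_exts s (f ` S) \<subseteq> linear_exts r S"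
      using r card bij by (auto simp: linear_exts_def intro: bij_betw_trans)
    show "(\<lambda>T. restrict (T \<circ> ?g) (f ` S)) ` linear_exts r S \<subseteq> linear_exts s (f ` S)"
      using r card inj bij_betw_inv_into[OF bij]
      by (auto simp: linear_exts_def intro: bij_betw_trans)
  qed
qed

text \<open>Since nothing in \<open>S\<close> lies above \<open>x\<close>, giving \<open>x\<close>
  the largest label violates no condition; removing that label leaves exactly the labels needed on
  \<open>S - {x}\<close>.\<close>

lemma bij_betw_linear_exts_delete:
  assumes fin: "finite S" and x: "x \<in> S" and max: "\<And>y. y \<in> S \<Longrightarrow> \<not> r x y"
  shows "bij_betw (\<lambda>T. T(x := card S)) (linear_exts r (S - {x}))
    {T \<in> linear_exts r S. T x = card S}"
proof (rule bij_betw_byWitness[where f' = "\<lambda>T. T(x := undefined)"])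
  obtain n where n: "card S = Suc n" "card (S - {x}) = n"
    using fin x by (metis card_Suc_Diff1)
  show "\<forall>T\<in>linear_exts r (S - {x}). (T(x := card S))(x := undefined) = T"
    by (auto simp: linear_exts_def extensional_def fun_eq_iff)
  show "\<forall>T\<in>{T \<in> linear_exts r S. T x = card S}. (T(x := undefined))(x := card S) = T"
    by auto
  show "(\<lambda>T. T(x := card S)) ` linear_exts r (S - {x}) \<subseteq> {T \<in> linear_exts r S. T x = card S}"
  proof (rule image_subsetI)
    fix T assume T: "T \<in> linear_exts r (S - {x})"
    let ?T = "T(x := Suc n)"
    have bij: "bij_betw T (S - {x}) {1..n}"
      using T n by (simp add: linear_exts_def)
    have "bij_betw ?T (S - {x}) {1..n}"
      using bij by (subst bij_betw_cong[where g = T]) auto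
    then have "bij_betw ?T (S - {x} \<union> {x}) ({1..n} \<union> {?T x})"
      by (intro notIn_Un_bij_betw) auto
    moreover have "S - {x} \<union> {x} = S"
      using x by blast
    moreover have "{1..n} \<union> {?T x} = {1..Suc n}"
      by auto
    ultimately have "bij_betw ?T S {1..Suc n}"
      by (simp only:)
    moreover have "T y < Suc n" if "y \<in> S" "y \<noteq> x" for y
      using that bij_betwE[OF bij] by (simp add: less_Suc_eq_le)
    ultimately have "?T \<in> linear_exts r S"
      using T max x n by (auto simp: linear_exts_def extensional_def)
    then show "T(x := card S) \<in> {T \<in> linear_exts r S. T x = card S}"
      using n by simp
  qed
  show "(\<lambda>T. T(x := undefined)) ` {T \<in> linear_exts r S. T x = card S} \<subseteq> linear_exts r (S - {x})"
  proof clarify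
    fix T assume T: "T \<in> linear_exts r S" and Tx: "T x = card S"
    have "bij_betw T S {1..Suc n}"
      using T n by (simp add: linear_exts_def)
    moreover have "bij_betw T {x} {Suc n}"
      using Tx n by (simp add: bij_betw_def)
    ultimately have "bij_betw T (S - {x}) ({1..Suc n} - {Suc n})"
      by (rule bij_betw_DiffI) (use x in auto)
    moreover have "{1..Suc n} - {Suc n} = {1..n}"
      by auto
    ultimately have "bij_betw (T(x := undefined)) (S - {x}) {1..n}"
      by (subst bij_betw_cong[where g = T]) auto
    then show "T(x := undefined) \<in> linear_exts r (S - {x})"
      using T n by (auto simp: linear_exts_def extensional_def)
  qed
qed

text \<open>Sort the labellings by the element that carries the largest label \<open>card S\<close>;
  it must be maximal, and deleting it gives the summand.\<close>

lemma card_linear_exts_rec: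
  assumes fin: "finite S" and ne: "S \<noteq> {}"
  shows "card (linear_exts r S) =
    (\<Sum>x | x \<in> S \<and> (\<forall>y\<in>S. \<not> r x y). card (linear_exts r (S - {x})))"
proof -
  let ?M = "{x \<in> S. \<forall>y\<in>S. \<not> r x y}" and ?L = "\<lambda>x. {T \<in> linear_exts r S. T x = card S}"
  have "linear_exts r S = (\<Union>x\<in>?M. ?L x)"
  proof
    show "linear_exts r S \<subseteq> (\<Union>x\<in>?M. ?L x)"
    proof
      fix T assume T: "T \<in> linear_exts r S"
      then have bij: "bij_betw T S {1..card S}"
        by (simp add: linear_exts_def)
      have "card S \<in> {1..card S}"
        using fin ne by (simp add: Suc_le_eq card_gt_0_iff)
      then have "card S \<in> T ` S"
        using bij by (simp add: bij_betw_def)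
      then obtain x where x: "x \<in> S" "T x = card S"
        by auto
      have "\<not> r x y" if "y \<in> S" for y
      proof
        assume "r x y"
        then have "card S < T y"
          using T x that by (auto simp: linear_exts_def)
        moreover have "T y \<in> {1..card S}"
          using bij_betwE[OF bij] that by blast
        ultimately show False
          by simp
      qed
      then show "T \<in> (\<Union>x\<in>?M. ?L x)"
        using T x by auto
    qed
  qed auto
  also have "card \<dots> = (\<Sum>x\<in>?M. card (?L x))"
  proof (rule card_UN_disjoint)
    show "\<forall>x\<in>?M. \<forall>y\<in>?M. x \<noteq> y \<longrightarrow> ?L x \<inter> ?L y = {}"
    proof (intro ballI impI)
      fix x y assume "x \<in> ?M" "y \<in> ?M" "x \<noteq> y"
      then have ne: "T x \<noteq> T y" if "T \<in> linear_exts r S" for T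
        using that by (auto simp: linear_exts_def bij_betw_def inj_on_def)
      show "?L x \<inter> ?L y = {}"
      proof (rule equals0I)
        fix T assume "T \<in> ?L x \<inter> ?L y"
        then have "T \<in> linear_exts r S" "T x = T y"
          by auto
        then show False
          using ne by blast
      qed
    qed
  qed (simp_all add: fin finite_linear_exts)
  also have "\<dots> = (\<Sum>x\<in>?M. card (linear_exts r (S - {x})))"
  proof (rule sum.cong)
    fix x assume "x \<in> ?M"
    then show "card (?L x) = card (linear_exts r (S - {x}))"
      using bij_betw_same_card[OF bij_betw_linear_exts_delete[OF fin, of x r]] by simp
  qed simp
  finally show ?thesis .
qed

section \<open>Chains of weakly decreasing integer vectors\<close>

text \<open>Integer entries have no lower bound, so the last one can always be lowered, just as the
  first can always be raised.\<close>

definition decreasing :: "nat \<Rightarrow> (nat \<Rightarrow> int) \<Rightarrow> bool" where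
  "decreasing k v \<longleftrightarrow> (\<forall>i. Suc i < k \<longrightarrow> v (Suc i) \<le> v i)"

abbreviation incr :: "nat \<Rightarrow> (nat \<Rightarrow> int) \<Rightarrow> nat \<Rightarrow> int" where
  "incr i v \<equiv> v(i := v i + 1)"

abbreviation decr :: "nat \<Rightarrow> (nat \<Rightarrow> int) \<Rightarrow> nat \<Rightarrow> int" where
  "decr i v \<equiv> v(i := v i - 1)"

lemma decreasing_antimono:
  assumes "decreasing k v" "i \<le> j" "j < k"
  shows "v j \<le> v i"
  using assms(2,3)
proof (induction j rule: dec_induct)
  case (step n)
  then show ?case
    using assms(1) by (force simp: decreasing_def)
qed simp

lemma decreasing_incr_iff:
  assumes "decreasing k v" "i < k"
  shows "decreasing k (incr i v) \<longleftrightarrow> i = 0 \<or> v i < v (i - 1)"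
  using assms by (cases i) (auto simp: decreasing_def add_increasing2 le_less)

lemma decreasing_decr_iff:
  assumes "decreasing k v" "i < k"
  shows "decreasing k (decr i v) \<longleftrightarrow> Suc i = k \<or> v (Suc i) < v i"
proof
  assume "decreasing k (decr i v)"
  then have "Suc i < k \<Longrightarrow> (decr i v) (Suc i) \<le> (decr i v) i"
    unfolding decreasing_def by blast
  with assms(2) show "Suc i = k \<or> v (Suc i) < v i"
    by (cases "Suc i = k") auto
next
  assume *: "Suc i = k \<or> v (Suc i) < v i"
  have "(decr i v) (Suc n) \<le> (decr i v) n" if "Suc n < k" for n
    using assms that * by (cases "n = i") (auto simp: decreasing_def add_increasing2 le_diff_eq
      intro: order_trans[of _ "v (Suc n)"])
  then show "decreasing k (decr i v)"
    by (simp add: decreasing_def)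
qed

text \<open>Raising entry \<open>i\<close> can only break its inequality with entry
  \<open>i - 1\<close>, and lowering another entry \<open>j\<close> never repairs that one. The
  argument for \<open>decr j v\<close> is symmetric, with entry \<open>Suc j\<close>.\<close>

lemma decreasing_incr_decrD:
  assumes "decreasing k v" "i < k" "j < k" "i \<noteq> j" "decreasing k ((incr i v)(j := v j - 1))"
  shows "decreasing k (incr i v)" "decreasing k (decr j v)"
proof -
  have *: "((incr i v)(j := v j - 1)) (Suc n) \<le> ((incr i v)(j := v j - 1)) n" if "Suc n < k" for n
    using assms(5) that by (simp add: decreasing_def)
  show "decreasing k (incr i v)"
    using *[of "i - 1"] assms(1-4) unfolding decreasing_incr_iff[OF assms(1,2)]
    by (cases i) (auto split: if_splits)
  show "decreasing k (decr j v)"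
    using *[of j] assms(1-4) unfolding decreasing_decr_iff[OF assms(1,3)]
    by (cases "Suc j = k") (auto split: if_splits)
qed

text \<open>Both sides count the maximal blocks of equal entries: the first index of a block can be
  raised, the last one lowered.\<close>

lemma card_incr_eq_card_decr:
  assumes "decreasing k v"
  shows "card {i. i < k \<and> decreasing k (incr i v)} = card {i. i < k \<and> decreasing k (decr i v)}"
proof (cases k)
  case (Suc m)
  \<comment> \<open>A descent at \<open>i\<close> allows lowering at \<open>i\<close> and raising at
    \<open>Suc i\<close>. The two sets are \<open>?D\<close> and its shift, each with one extra
    index: \<open>m\<close> at the end, \<open>0\<close> at the start.\<close>
  let ?D = "{i. i < m \<and> v (Suc i) < v i}"
  have "{i. i < k \<and> decreasing k (incr i v)} = {i. i < k \<and> (i = 0 \<or> v i < v (i - 1))}"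
    using decreasing_incr_iff[OF assms] by blast
  also have "\<dots> = insert 0 (Suc ` ?D)"
  proof (intro set_eqI)
    show "i \<in> {i. i < k \<and> (i = 0 \<or> v i < v (i - 1))} \<longleftrightarrow> i \<in> insert 0 (Suc ` ?D)" for i
      by (cases i) (auto simp: Suc)
  qed
  finally have "card {i. i < k \<and> decreasing k (incr i v)} = Suc (card ?D)"
    by (simp add: card_image)
  moreover have "{i. i < k \<and> decreasing k (decr i v)} = {i. i < k \<and> (Suc i = k \<or> v (Suc i) < v i)}"
    using decreasing_decr_iff[OF assms] by blast
  moreover have "\<dots> = insert m ?D"
    by (auto simp: Suc)
  ultimately show ?thesis
    by simp
qed simp

text \<open>The identity D U = U D at \<open>v\<close>, tested against an arbitrary \<open>F\<close>
  instead of being stated with formal sums.\<close>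

lemma decr_incr_commute:
  fixes F :: "(nat \<Rightarrow> int) \<Rightarrow> nat"
  assumes v: "decreasing k v"
  shows "(\<Sum>i | i < k \<and> decreasing k (incr i v).
           \<Sum>j | j < k \<and> decreasing k (decr j (incr i v)). F (decr j (incr i v))) =
         (\<Sum>j | j < k \<and> decreasing k (decr j v).
           \<Sum>i | i < k \<and> decreasing k (incr i (decr j v)). F (incr i (decr j v)))"
    (is "?L = ?R")
proof -
  \<comment> \<open>The off-diagonal terms, in a form common to both orders. The value 0 at
    forbidden vectors lets both outer sums run over all indices below \<open>k\<close>, after which
    they can be swapped.\<close>
  define G where "G i j = (if i \<noteq> j \<and> decreasing k ((incr i v)(j := v j - 1))
    then F ((incr i v)(j := v j - 1)) else 0)" for i j
  have swap: "incr i (decr j v) = (incr i v)(j := v j - 1)" if "i \<noteq> j" for i j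
    using that by auto
  have cancel: "incr j (decr j v) = v" for j
    by auto
  have L: "(\<Sum>j | j < k \<and> decreasing k (decr j (incr i v)). F (decr j (incr i v))) =
      F v + (\<Sum>j<k. G i j)" if "i < k" for i
  proof -
    have "(\<Sum>j | j < k \<and> decreasing k (decr j (incr i v)). F (decr j (incr i v))) =
        (\<Sum>j<k. if decreasing k (decr j (incr i v)) then F (decr j (incr i v)) else 0)"
      by (subst sum.inter_filter[symmetric]) auto
    also have "\<dots> = (\<Sum>j<k. (if j = i then F v else 0) + G i j)"
      by (rule sum.cong) (auto simp: G_def v)
    finally show ?thesis
      using that by (simp add: sum.distrib)
  qed
  have R: "(\<Sum>i | i < k \<and> decreasing k (incr i (decr j v)). F (incr i (decr j v))) =
      F v + (\<Sum>i<k. G i j)" if "j < k" for j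
  proof -
    have "(\<Sum>i | i < k \<and> decreasing k (incr i (decr j v)). F (incr i (decr j v))) =
        (\<Sum>i<k. if decreasing k (incr i (decr j v)) then F (incr i (decr j v)) else 0)"
      by (subst sum.inter_filter[symmetric]) auto
    also have "\<dots> = (\<Sum>i<k. (if i = j then F v else 0) + G i j)"
      by (rule sum.cong) (auto simp: G_def v swap cancel simp del: fun_upd_apply fun_upd_upd)
    finally show ?thesis
      using that by (simp add: sum.distrib)
  qed
  have "?L = card {i. i < k \<and> decreasing k (incr i v)} * F v +
      (\<Sum>i | i < k \<and> decreasing k (incr i v). \<Sum>j<k. G i j)"
    by (simp add: L sum.distrib del: fun_upd_apply)
  also have "(\<Sum>i | i < k \<and> decreasing k (incr i v). \<Sum>j<k. G i j) = (\<Sum>i<k. \<Sum>j<k. G i j)"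
    using decreasing_incr_decrD(1)[OF v]
    by (intro sum.mono_neutral_left) (auto simp: G_def simp del: fun_upd_apply)
  also have "\<dots> = (\<Sum>j<k. \<Sum>i<k. G i j)"
    by (rule sum.swap)
  also have "\<dots> = (\<Sum>j | j < k \<and> decreasing k (decr j v). \<Sum>i<k. G i j)"
    using decreasing_incr_decrD(2)[OF v]
    by (intro sum.mono_neutral_right) (auto simp: G_def simp del: fun_upd_apply)
  also have "card {i. i < k \<and> decreasing k (incr i v)} = card {i. i < k \<and> decreasing k (decr i v)}"
    by (rule card_incr_eq_card_decr[OF v])
  finally show ?thesis
    by (simp add: R sum.distrib del: fun_upd_apply)
qed

text \<open>The coefficient of \<open>l\<close> in U^n \<open>m\<close> for weakly decreasing
  \<open>m\<close> and \<open>l\<close>. Steps are peeled off at the upper end, to match the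
  deletion of the box with the largest label; \<open>l\<close> itself is not tested.\<close>

fun num_chains :: "nat \<Rightarrow> nat \<Rightarrow> (nat \<Rightarrow> int) \<Rightarrow> (nat \<Rightarrow> int) \<Rightarrow> nat" where
  "num_chains k 0 m l = (if m = l then 1 else 0)"
| "num_chains k (Suc n) m l = (\<Sum>i | i < k \<and> decreasing k (decr i l). num_chains k n m (decr i l))"

lemma num_chains_eq_0:
  assumes "l i < m i"
  shows "num_chains k n m l = 0"
  using assms
proof (induction n arbitrary: l)
  case (Suc n)
  then have "decr j l i < m i" for j
    by (cases "i = j") auto
  with Suc.IH show ?case
    by simp
qed auto

text \<open>The coefficient of \<open>l\<close> in D U^n \<open>m\<close> = U^n D \<open>m\<close>.
  The induction moves D past one U at a time, at the upper end of the chain, so \<open>l\<close>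
  must vary.\<close>

lemma sum_num_chains_incr_eq_sum_num_chains_decr:
  assumes "decreasing k m" "decreasing k l"
  shows "(\<Sum>i | i < k \<and> decreasing k (incr i l). num_chains k n m (incr i l)) =
    (\<Sum>i | i < k \<and> decreasing k (decr i m). num_chains k n (decr i m) l)"
  using assms(2)
proof (induction n arbitrary: l)
  case 0
  have nested_if: "(if A then if B then 1 else 0 else 0) = (if A \<and> B then 1 else 0 :: nat)" for A B
    by simp
  \<comment> \<open>With no steps in the chain, both sides ask whether \<open>m\<close> is
    \<open>l\<close> raised at \<open>i\<close>; the vectors tested are then \<open>m\<close> and
    \<open>l\<close>, both weakly decreasing by assumption.\<close>
  have "decreasing k (incr i l) \<and> m = incr i l \<longleftrightarrow> decreasing k (decr i m) \<and> decr i m = l" for i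
  proof -
    have "m = incr i l \<longleftrightarrow> decr i m = l"
      by (auto simp: fun_eq_iff)
    then show ?thesis
      using assms(1) 0 by metis
  qed
  then have "(if decreasing k (incr i l) then num_chains k 0 m (incr i l) else 0) =
      (if decreasing k (decr i m) then num_chains k 0 (decr i m) l else 0)" for i
    by (simp only: num_chains.simps nested_if)
  then have "(\<Sum>i<k. if decreasing k (incr i l) then num_chains k 0 m (incr i l) else 0) =
      (\<Sum>i<k. if decreasing k (decr i m) then num_chains k 0 (decr i m) l else 0)"
    by (intro sum.cong refl)
  then show ?case
    by (simp only: sum.inter_filter[symmetric] finite_lessThan lessThan_iff)
next
  case (Suc n)
  have "(\<Sum>i | i < k \<and> decreasing k (incr i l). num_chains k (Suc n) m (incr i l)) =
      (\<Sum>j | j < k \<and> decreasing k (decr j l).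
        \<Sum>i | i < k \<and> decreasing k (incr i (decr j l)). num_chains k n m (incr i (decr j l)))"
    unfolding num_chains.simps by (rule decr_incr_commute[OF Suc.prems])
  also have "\<dots> = (\<Sum>j | j < k \<and> decreasing k (decr j l).
      \<Sum>i | i < k \<and> decreasing k (decr i m). num_chains k n (decr i m) (decr j l))"
    by (rule sum.cong[OF refl], rule Suc.IH) blast
  also have "\<dots> = (\<Sum>i | i < k \<and> decreasing k (decr i m). num_chains k (Suc n) (decr i m) l)"
    unfolding num_chains.simps by (rule sum.swap)
  finally show ?case .
qed

section \<open>Skew diagrams\<close>

text \<open>Columns are integers, so a box can be added on the left of any column without
  translating the shape.\<close>

definition skew_diagram :: "nat \<Rightarrow> (nat \<Rightarrow> int) \<Rightarrow> (nat \<Rightarrow> int) \<Rightarrow> (nat \<times> int) set" where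
  "skew_diagram k l m = {(i, j). i < k \<and> m i < j \<and> j \<le> l i}"

definition box_less :: "nat \<times> 'a::linorder \<Rightarrow> nat \<times> 'a \<Rightarrow> bool" where
  "box_less p q \<longleftrightarrow> fst p = fst q \<and> snd p < snd q \<or> snd p = snd q \<and> fst p < fst q"

lemma finite_skew_diagram: "finite (skew_diagram k l m)"
proof (rule finite_subset)
  show "skew_diagram k l m \<subseteq> (SIGMA i:{..<k}. {m i<..l i})"
    by (auto simp: skew_diagram_def)
qed auto

lemma skew_diagram_decr:
  "skew_diagram k (decr i l) m = skew_diagram k l m - {(i, l i)}"
  by (auto simp: skew_diagram_def split: if_splits)

lemma card_skew_diagram_incr:
  assumes "i < k" "m i \<le> l i"
  shows "card (skew_diagram k (incr i l) m) = Suc (card (skew_diagram k l m))"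
proof -
  have "skew_diagram k (incr i l) m = insert (i, l i + 1) (skew_diagram k l m)"
    using assms by (auto simp: skew_diagram_def split: if_splits)
  moreover have "(i, l i + 1) \<notin> skew_diagram k l m"
    by (simp add: skew_diagram_def)
  ultimately show ?thesis
    by (simp add: finite_skew_diagram)
qed

lemma card_skew_diagram_decr_inner:
  assumes "i < k" "m i \<le> l i"
  shows "card (skew_diagram k l (decr i m)) = Suc (card (skew_diagram k l m))"
proof -
  have "skew_diagram k l (decr i m) = insert (i, m i) (skew_diagram k l m)"
    using assms by (auto simp: skew_diagram_def split: if_splits)
  moreover have "(i, m i) \<notin> skew_diagram k l m"
    by (simp add: skew_diagram_def)
  ultimately show ?thesis
    by (simp add: finite_skew_diagram)
qed

text \<open>A maximal box ends its row and has no box below it, so removing it leaves a skew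
  diagram. The condition \<open>m i < l i\<close> discards empty rows, where \<open>l\<close> may be
  lowerable but no box exists.\<close>

lemma maximal_boxes:
  assumes m: "decreasing k m" and l: "decreasing k l"
  shows "{x \<in> skew_diagram k l m. \<forall>y\<in>skew_diagram k l m. \<not> box_less x y} =
    (\<lambda>i. (i, l i)) ` {i. i < k \<and> m i < l i \<and> decreasing k (decr i l)}" (is "?M = ?I")
proof
  show "?M \<subseteq> ?I"
  proof clarify
    fix i j assume ij: "(i, j) \<in> skew_diagram k l m"
      and max: "\<forall>y\<in>skew_diagram k l m. \<not> box_less (i, j) y"
    have i: "i < k" "m i < j" "j \<le> l i"
      using ij by (auto simp: skew_diagram_def)
    have "(i, l i) \<in> skew_diagram k l m"
      using i by (auto simp: skew_diagram_def)
    then have j: "j = l i"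
      using max i(3) by (fastforce simp: box_less_def)
    have "l (Suc i) < l i" if "Suc i < k"
    proof (rule ccontr)
      assume "\<not> l (Suc i) < l i"
      moreover have "m (Suc i) \<le> m i"
        using m that by (simp add: decreasing_def)
      ultimately have "(Suc i, j) \<in> skew_diagram k l m"
        using i j that by (auto simp: skew_diagram_def)
      then show False
        using max by (auto simp: box_less_def)
    qed
    then have "decreasing k (decr i l)"
      using decreasing_decr_iff[OF l i(1)] i(1) by (cases "Suc i = k") auto
    then show "(i, j) \<in> ?I"
      using i j by auto
  qed
  show "?I \<subseteq> ?M"
  proof clarify
    fix i assume i: "i < k" "m i < l i" "decreasing k (decr i l)"
    have "\<not> box_less (i, l i) (i', j)" if "(i', j) \<in> skew_diagram k l m" for i' j
    proof
      assume "box_less (i, l i) (i', j)"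
      then have "i < i'" "j = l i" "i' < k" "l i \<le> l i'"
        using that by (auto simp: box_less_def skew_diagram_def)
      \<comment> \<open>\<open>box_less\<close> also compares boxes in distant rows of a column;
        monotonicity of \<open>l\<close> reduces this to the adjacent row
        \<open>Suc i\<close>.\<close>
      moreover from this have "l i' \<le> l (Suc i)" "Suc i < k"
        using decreasing_antimono[OF l, of "Suc i" i'] by auto
      ultimately show False
        using i decreasing_decr_iff[OF l i(1)] by auto
    qed
    then show "(i, l i) \<in> skew_diagram k l m \<and> (\<forall>y\<in>skew_diagram k l m. \<not> box_less (i, l i) y)"
      using i by (auto simp: skew_diagram_def)
  qed
qed

text \<open>Deleting the box with the largest label lowers one entry of \<open>l\<close>, which is
  the recursion of \<open>num_chains\<close>. Agreement from index \<open>k\<close> on matters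
  because the base case compares whole functions.\<close>

lemma card_linear_exts_skew_diagram:
  assumes "decreasing k m" "decreasing k l"
    and "\<And>i. m i \<le> l i" "\<And>i. k \<le> i \<Longrightarrow> m i = l i"
  shows "card (linear_exts box_less (skew_diagram k l m)) =
    num_chains k (card (skew_diagram k l m)) m l"
  using assms(2-4)
proof (induction "card (skew_diagram k l m)" arbitrary: l)
  case 0
  then have empty: "skew_diagram k l m = {}"
    by (simp add: finite_skew_diagram)
  have "m i = l i" for i
  proof (rule ccontr)
    assume "m i \<noteq> l i"
    then have "(i, l i) \<in> skew_diagram k l m"
      using 0(3)[of i] 0(4)[of i] by (auto simp: skew_diagram_def not_le[symmetric])
    then show False
      using empty by simp
  qed
  then have "m = l" ..
  with empty show ?case
    by (simp add: linear_exts_empty)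
next
  case (Suc n)
  let ?S = "skew_diagram k l m"
  let ?I = "{i. i < k \<and> m i < l i \<and> decreasing k (decr i l)}"
  have "card (linear_exts box_less ?S) =
      (\<Sum>x\<in>(\<lambda>i. (i, l i)) ` ?I. card (linear_exts box_less (?S - {x})))"
    unfolding maximal_boxes[OF assms(1) Suc.prems(1), symmetric]
    using Suc.hyps(2) by (intro card_linear_exts_rec finite_skew_diagram) auto
  also have "\<dots> = (\<Sum>i\<in>?I. card (linear_exts box_less (?S - {(i, l i)})))"
    by (subst sum.reindex) (auto simp: inj_on_def)
  also have "\<dots> = (\<Sum>i\<in>?I. num_chains k n m (decr i l))"
  proof (rule sum.cong)
    fix i assume i: "i \<in> ?I"
    have "(i, l i) \<in> ?S"
      using i by (simp add: skew_diagram_def)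
    then have n: "n = card (skew_diagram k (decr i l) m)"
      unfolding skew_diagram_decr using Suc.hyps(2) finite_skew_diagram[of k l m] by simp
    show "card (linear_exts box_less (?S - {(i, l i)})) = num_chains k n m (decr i l)"
      using Suc.hyps(1)[OF n] i Suc.prems n by (simp flip: skew_diagram_decr)
  qed simp
  \<comment> \<open>The added indices are empty rows: there \<open>decr i l\<close> drops below
    \<open>m\<close>, and no chain leads from \<open>m\<close> to it.\<close>
  also have "\<dots> = (\<Sum>i | i < k \<and> decreasing k (decr i l). num_chains k n m (decr i l))"
  proof (rule sum.mono_neutral_left)
    show "\<forall>i\<in>{i. i < k \<and> decreasing k (decr i l)} - ?I. num_chains k n m (decr i l) = 0"
    proof
      fix i assume "i \<in> {i. i < k \<and> decreasing k (decr i l)} - ?I"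
      then have "decr i l i < m i"
        by auto
      then show "num_chains k n m (decr i l) = 0"
        by (rule num_chains_eq_0)
    qed
  qed auto
  finally show ?case
    by (simp flip: Suc.hyps(2))
qed

section \<open>From lists of parts to integer vectors\<close>

text \<open>The offset \<open>c\<close> undoes the translation to the right in \<open>add_left\<close>.\<close>

definition vec :: "int \<Rightarrow> nat list \<Rightarrow> nat \<Rightarrow> int" where
  "vec c xs i = (if i < length xs then int (xs ! i) - c else 0)"

lemma standard_fillings_eq_linear_exts:
  "standard_fillings \<sigma> = linear_exts box_less (boxes \<sigma>)"
  unfolding standard_fillings_def linear_exts_def box_less_def
  by (intro Collect_cong) (auto simp: Ball_def)

lemma decreasing_vec:
  assumes "skew_shape (lam, mu)"
  shows "decreasing (length lam) (vec c lam)" "decreasing (length lam) (vec c mu)"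
  using assms by (auto simp: skew_shape_iff_nth decreasing_def vec_def simp del: skew_shape.simps)

text \<open>Subtracting the same \<open>c\<close> from all columns is injective and preserves
  \<open>box_less\<close>, so the count is the same for every offset.\<close>

lemma num_standard_eq_num_chains:
  fixes c :: int
  assumes "skew_shape (lam, mu)"
  defines "k \<equiv> length lam" and "l \<equiv> vec c lam" and "m \<equiv> vec c mu"
  shows "num_standard (lam, mu) = num_chains k (card (skew_diagram k l m)) m l"
proof -
  have len: "length mu = k" and le: "\<And>i. i < k \<Longrightarrow> mu ! i \<le> lam ! i"
    using assms by (auto simp: skew_shape_iff_nth simp del: skew_shape.simps)
  let ?f = "\<lambda>(i::nat, j). (i, int j - c)"
  have "?f ` boxes (lam, mu) = skew_diagram k l m"
  proof
    show "skew_diagram k l m \<subseteq> ?f ` boxes (lam, mu)"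
    proof clarify
      fix i j assume ij: "(i, j) \<in> skew_diagram k l m"
      then have "(i, nat (j + c)) \<in> boxes (lam, mu)" "(i, j) = ?f (i, nat (j + c))"
        by (auto simp: skew_diagram_def vec_def l_def m_def k_def len)
      then show "(i, j) \<in> ?f ` boxes (lam, mu)"
        by blast
    qed
  qed (auto simp: skew_diagram_def vec_def l_def m_def k_def len)
  moreover have "card (linear_exts box_less (?f ` boxes (lam, mu))) =
      card (linear_exts box_less (boxes (lam, mu)))"
    by (rule card_linear_exts_image) (auto simp: inj_on_def box_less_def)
  ultimately show ?thesis
    using card_linear_exts_skew_diagram[of k m l] decreasing_vec[OF assms(1), of c] len le
    by (simp add: num_standard_def standard_fillings_eq_linear_exts l_def m_def k_def vec_def)
qed

section \<open>The summands of the theorem as chain counts\<close>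

lemma num_standard_right_eq_num_chains:
  assumes shape: "skew_shape (lam, mu)" and i: "i < length lam"
  defines "k \<equiv> length lam" and "l \<equiv> vec 0 lam" and "m \<equiv> vec 0 mu"
  shows "num_standard_right i (lam, mu) = (if decreasing k (incr i l)
    then num_chains k (Suc (card (skew_diagram k l m))) m (incr i l) else 0)"
proof -
  have dec: "decreasing k l"
    using decreasing_vec[OF shape] by (simp add: k_def l_def)
  have iff: "skew_shape (add_right i (lam, mu)) \<longleftrightarrow> decreasing k (incr i l)"
    unfolding skew_shape_add_right_iff[OF shape i] decreasing_incr_iff[OF dec i[folded k_def]]
    using i by (auto simp: l_def vec_def)
  have "m i \<le> l i"
    using shape i by (auto simp: skew_shape_iff_nth l_def m_def vec_def simp del: skew_shape.simps)
  moreover have "vec 0 (lam[i := lam ! i + 1]) = incr i l"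
    using i by (auto simp: l_def vec_def fun_eq_iff)
  ultimately show ?thesis
    unfolding num_standard_right_def iff
    using num_standard_eq_num_chains[of "lam[i := lam ! i + 1]" mu 0] iff i
      card_skew_diagram_incr[of i k m l]
    by (simp add: k_def m_def del: skew_shape.simps)
qed

lemma num_standard_left_eq_num_chains:
  assumes shape: "skew_shape (lam, mu)" and i: "i < length lam"
  defines "k \<equiv> length lam" and "l \<equiv> vec 0 lam" and "m \<equiv> vec 0 mu"
  shows "num_standard_left i (lam, mu) = (if decreasing k (decr i m)
    then num_chains k (Suc (card (skew_diagram k l m))) (decr i m) l else 0)"
proof -
  have len: "length mu = length lam"
    using shape by (auto simp: skew_shape_iff_nth simp del: skew_shape.simps)
  have dec: "decreasing k m"
    using decreasing_vec[OF shape] by (simp add: k_def m_def)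
  have iff: "skew_shape (add_left i (lam, mu)) \<longleftrightarrow> decreasing k (decr i m)"
    unfolding skew_shape_add_left_iff[OF shape i] decreasing_decr_iff[OF dec i[folded k_def]]
    using i len by (auto simp: m_def k_def vec_def)
  have "m i \<le> l i"
    using shape i by (auto simp: skew_shape_iff_nth l_def m_def vec_def simp del: skew_shape.simps)
  then have card: "card (skew_diagram k l (decr i m)) = Suc (card (skew_diagram k l m))"
    using card_skew_diagram_decr_inner[of i k m l] i by (simp add: k_def)
  have "num_standard (add_left i (lam, mu)) =
      num_chains k (card (skew_diagram k l (decr i m))) (decr i m) l"
    if sh: "skew_shape (add_left i (lam, mu))"
  proof (cases "mu ! i = 0")
    case True
    \<comment> \<open>Offset 1 cancels the translation: all entries return to their old values,
      except that the new 0 in row \<open>i\<close> becomes -1, which is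
      \<open>m i - 1\<close>.\<close>
    have "vec 1 (map Suc lam) = l" "vec 1 ((map Suc mu)[i := 0]) = decr i m"
      using i len True by (auto simp: l_def m_def vec_def fun_eq_iff)
    then show ?thesis
      using num_standard_eq_num_chains[of "map Suc lam" "(map Suc mu)[i := 0]" 1] sh True
      by (simp add: k_def del: skew_shape.simps)
  next
    case False
    have "vec 0 (mu[i := mu ! i - 1]) = decr i m"
      using i len False by (auto simp: m_def vec_def fun_eq_iff)
    then show ?thesis
      using num_standard_eq_num_chains[of lam "mu[i := mu ! i - 1]" 0] sh False
      by (simp add: k_def l_def del: skew_shape.simps)
  qed
  then show ?thesis
    unfolding num_standard_left_def using iff card by simp
qed

theorem corollary2p15:
  fixes \<sigma> :: skew
  assumes "skew_shape \<sigma>"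
  shows "(\<Sum>i<num_rows \<sigma>. num_standard_left i \<sigma>) = (\<Sum>i<num_rows \<sigma>. num_standard_right i \<sigma>)"
proof -
  obtain lam mu where \<sigma>: "\<sigma> = (lam, mu)"
    by (cases \<sigma>)
  with assms have shape: "skew_shape (lam, mu)"
    by simp
  define k l m where "k = length lam" and "l = vec 0 lam" and "m = vec 0 mu"
  let ?n = "Suc (card (skew_diagram k l m))"
  have "(\<Sum>i<num_rows \<sigma>. num_standard_left i \<sigma>) =
      (\<Sum>i<k. if decreasing k (decr i m) then num_chains k ?n (decr i m) l else 0)"
    unfolding k_def l_def m_def \<sigma> using num_standard_left_eq_num_chains[OF shape]
    by (intro sum.cong) (auto simp del: num_chains.simps fun_upd_apply)
  also have "\<dots> = (\<Sum>i | i < k \<and> decreasing k (decr i m). num_chains k ?n (decr i m) l)"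
    by (simp only: sum.inter_filter[symmetric] finite_lessThan lessThan_iff)
  \<comment> \<open>Either way the new shape has \<open>?n\<close> boxes, so chains of the same
    length are counted on both sides and commutation applies.\<close>
  also have "\<dots> = (\<Sum>i | i < k \<and> decreasing k (incr i l). num_chains k ?n m (incr i l))"
    using decreasing_vec[OF shape] unfolding k_def l_def m_def
    by (intro sum_num_chains_incr_eq_sum_num_chains_decr[symmetric])
  also have "\<dots> = (\<Sum>i<k. if decreasing k (incr i l) then num_chains k ?n m (incr i l) else 0)"
    by (simp only: sum.inter_filter[symmetric] finite_lessThan lessThan_iff)
  also have "\<dots> = (\<Sum>i<num_rows \<sigma>. num_standard_right i \<sigma>)"
    unfolding k_def l_def m_def \<sigma> using num_standard_right_eq_num_chains[OF shape]
    by (intro sum.cong) (auto simp del: num_chains.simps fun_upd_apply)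
  finally show ?thesis .
qed

end
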